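(* For each integer $c\ge 1$ there exists a polynomial $P$ (depending only on $c$) such that the following holds. Let $r\ge 1$, let $N_{r,c}$ be the free nilpotent group of rank $r$ and class $c$ with free generators $x_1,\dots,x_r$, let $y_1,\dots,y_m$ be any Malcev basis of iterated commutators for $N_{r,c}$, and let $w$ be any group word in $x_1^{\pm1},\dots,x_r^{\pm1}$. Then there are integers $\alpha_1,\dots,\alpha_m$ such that $$w=y_1^{\alpha_1}\cdots y_m^{\alpha_m}$$ in $N_{r,c}$ and $|\alpha_i|\le P(|w|)$ for all $i=1,\dots,m$, where $|w|$ is the length of the word $w$.
   Context: A Malcev basis of iterated commutators for $N_{r,c}$ is defined as follows. Put $y_{11}=x_1,\dots,y_{1r}=x_r$. For $2\le i\le c$, let $y_{i1},\dots,y_{ij_i}$ be left-normed iterated commutators $[\dots[x_{a_1}^{\pm1},x_{a_2}^{\pm1}],\dots,x_{a_i}^{\pm1}]^{\pm1}$ of weight $i$ in the generators whose images form a basis of the free abelian group $\gamma_i(N_{r,c})/\gamma_{i+1}(N_{r,c})$, where $\gamma_i$ denotes the $i$th term of the lower central series. The list $y_{11},\dots,y_{1r},y_{21},\dots,y_{cj_c}$ is renamed $y_1,\dots,y_m$, ordered by weight (so $y_1=x_1,\dots,y_r=x_r$). *)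

theory Defs
  imports Main "HOL-Computational_Algebra.Polynomial"
begin

text \<open>Group words: a letter (a, True) stands for the generator x_(a+1), (a, False) for its inverse.\<close>
type_synonym letter = "nat \<times> bool"
type_synonym word = "letter list"

definition winv :: "word \<Rightarrow> word" where
  "winv w = rev (map (\<lambda>(a, s). (a, \<not> s)) w)"

definition wcomm :: "word \<Rightarrow> word \<Rightarrow> word" where
  "wcomm u v = winv u @ winv v @ u @ v"

fun lcomm :: "word list \<Rightarrow> word" where
  "lcomm [] = []"
| "lcomm (u # us) = foldl wcomm u us"

definition wpow :: "word \<Rightarrow> int \<Rightarrow> word" where
  "wpow w e = (if 0 \<le> e then concat (replicate (nat e) w)
               else concat (replicate (nat (- e)) (winv w)))"

definition wprod :: "word list \<Rightarrow> int list \<Rightarrow> word" where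
  "wprod ys es = concat (map2 wpow ys es)"

definition over :: "nat \<Rightarrow> word \<Rightarrow> bool" where
  "over r w \<longleftrightarrow> (\<forall>l \<in> set w. fst l < r)"

inductive wcong :: "word set \<Rightarrow> word \<Rightarrow> word \<Rightarrow> bool" for R where
  refl: "wcong R w w"
| sym: "wcong R w v \<Longrightarrow> wcong R v w"
| trans: "wcong R u v \<Longrightarrow> wcong R v w \<Longrightarrow> wcong R u w"
| ctx: "wcong R w v \<Longrightarrow> wcong R (a @ w @ b) (a @ v @ b)"
| cancel: "wcong R [(i, s), (i, \<not> s)] []"
| rel: "u \<in> R \<Longrightarrow> wcong R u []"

abbreviation free_eq :: "word \<Rightarrow> word \<Rightarrow> bool" where
  "free_eq \<equiv> wcong {}"

definition comm_relators :: "nat \<Rightarrow> nat \<Rightarrow> word set" where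
  "comm_relators r k = {lcomm us | us. length us = k \<and> (\<forall>u \<in> set us. over r u)}"

text \<open>Equality in N_(r,c) = F_r / gamma_(c+1)(F_r).\<close>
definition nil_eq :: "nat \<Rightarrow> nat \<Rightarrow> word \<Rightarrow> word \<Rightarrow> bool" where
  "nil_eq r c = wcong (comm_relators r (Suc c))"

inductive in_gamma :: "nat \<Rightarrow> nat \<Rightarrow> word \<Rightarrow> bool" for r k where
  one: "in_gamma r k []"
| gen: "u \<in> comm_relators r k \<Longrightarrow> in_gamma r k u"
| mult: "in_gamma r k u \<Longrightarrow> in_gamma r k v \<Longrightarrow> in_gamma r k (u @ v)"
| inv: "in_gamma r k u \<Longrightarrow> in_gamma r k (winv u)"
| eq: "in_gamma r k u \<Longrightarrow> free_eq u v \<Longrightarrow> in_gamma r k v"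

definition basic_comm :: "nat \<Rightarrow> nat \<Rightarrow> word \<Rightarrow> bool" where
  "basic_comm r i y \<longleftrightarrow> (\<exists>as :: letter list. length as = i \<and> over r as \<and>
      (y = lcomm (map (\<lambda>l. [l]) as) \<or> y = winv (lcomm (map (\<lambda>l. [l]) as))))"

text \<open>The images of the words ys form a basis of the free abelian group
  gamma_i(N_(r,c))/gamma_(i+1)(N_(r,c)) = gamma_i(F_r)/gamma_(i+1)(F_r)  (for i <= c).\<close>
definition layer_basis :: "nat \<Rightarrow> nat \<Rightarrow> word list \<Rightarrow> bool" where
  "layer_basis r i ys \<longleftrightarrow>
     (\<forall>w. in_gamma r i w \<longrightarrow> (\<exists>es. length es = length ys \<and> nil_eq r i w (wprod ys es))) \<and>
     (\<forall>es. length es = length ys \<longrightarrow> nil_eq r i (wprod ys es) [] \<longrightarrow> (\<forall>e \<in> set es. e = 0))"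

definition malcev_comm_basis :: "nat \<Rightarrow> nat \<Rightarrow> (nat \<Rightarrow> word list) \<Rightarrow> bool" where
  "malcev_comm_basis r c B \<longleftrightarrow>
     B 1 = map (\<lambda>a. [(a, True)]) [0..<r] \<and>
     (\<forall>i \<in> {2..c}. (\<forall>y \<in> set (B i). basic_comm r i y) \<and> layer_basis r i (B i))"

definition malcev_list :: "nat \<Rightarrow> (nat \<Rightarrow> word list) \<Rightarrow> word list" where
  "malcev_list c B = concat (map B [1..<Suc c])"

end

theory Submission
  imports Defs Complex_Main
begin

text \<open>Write the word as a product of signed commutators of letters and collect weight by weight.
  At weight k, each commutator is first rewritten through the given basis, which costs a constant
  number of factors of weight at least k; the basis elements are then moved to the left one at a
  time. Moving one of them conjugates the factors it passes, and each of these produces a bounded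
  number of factors of higher weight. Weighting a factor of weight j by E^(c - j), one move multiplies
  the total by at most 1 + D/E, so T moves with E at least D T cost a factor of at most e, and the
  number of factors left is polynomial in the number at the start.

  Independence of the rank and of the basis comes from killing and renaming letters: a commutator of
  weight at most c lives on at most c letters, so only finitely many configurations occur.\<close>

section \<open>Words and congruences\<close>

lemma winv_Nil [simp]: "winv [] = []"
  by (simp add: winv_def)

lemma winv_append [simp]: "winv (u @ v) = winv v @ winv u"
  by (simp add: winv_def)

lemma winv_single [simp]: "winv [l] = [(fst l, \<not> snd l)]"
  by (simp add: winv_def case_prod_beta)

lemma winv_Cons: "winv (l # w) = winv w @ [(fst l, \<not> snd l)]"
  by (simp add: winv_def case_prod_beta)

lemma winv_winv [simp]: "winv (winv w) = w"
  by (simp add: winv_def rev_map o_def case_prod_beta)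

lemma length_winv [simp]: "length (winv w) = length w"
  by (simp add: winv_def)

lemma over_Nil [simp]: "over r []"
  and over_Cons [simp]: "over r (l # w) \<longleftrightarrow> fst l < r \<and> over r w"
  and over_append [simp]: "over r (u @ v) \<longleftrightarrow> over r u \<and> over r v"
  by (auto simp: over_def)

lemma over_winv [simp]: "over r (winv w) \<longleftrightarrow> over r w"
  by (auto simp: over_def winv_def)

lemma over_concat: "over r (concat ws) \<longleftrightarrow> (\<forall>w \<in> set ws. over r w)"
  by (auto simp: over_def)

lemma lcomm_snoc: "us \<noteq> [] \<Longrightarrow> lcomm (us @ [u]) = wcomm (lcomm us) u"
  by (cases us) auto

lemma over_lcomm: "(\<forall>u \<in> set us. over r u) \<Longrightarrow> over r (lcomm us)"
proof (induction us rule: rev_induct)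
  case (snoc u us)
  then show ?case by (cases "us = []") (auto simp: lcomm_snoc wcomm_def)
qed simp

declare wcong.trans [trans]

lemma wcong_append:
  assumes "wcong R u u'" "wcong R v v'"
  shows "wcong R (u @ v) (u' @ v')"
proof -
  have "wcong R (u @ v) (u' @ v)" using wcong.ctx[OF assms(1), of "[]" v] by simp
  moreover have "wcong R (u' @ v) (u' @ v')" using wcong.ctx[OF assms(2), of u' "[]"] by simp
  ultimately show ?thesis by (rule wcong.trans)
qed

lemma wcong_inv_right: "wcong R (w @ winv w) []"
proof (induction w)
  case (Cons l w)
  obtain i s where l: "l = (i, s)" by (cases l)
  have "wcong R ([l] @ (w @ winv w) @ winv [l]) ([l] @ [] @ winv [l])"
    by (rule wcong.ctx[OF Cons])
  also have "wcong R \<dots> []" using wcong.cancel[of R i s] by (simp add: l)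
  finally show ?case by (simp add: winv_Cons)
qed (simp add: wcong.refl)

lemma wcong_inv_left: "wcong R (winv w @ w) []"
  using wcong_inv_right[of R "winv w"] by simp

lemma wcong_cancel_left: "wcong R (a @ winv w @ w @ b) (a @ b)"
  using wcong.ctx[OF wcong_inv_left, of R a w b] by simp

lemma wcong_cancel_right: "wcong R (a @ w @ winv w @ b) (a @ b)"
  using wcong_cancel_left[of R a "winv w" b] by simp

lemma wcong_winv:
  assumes "wcong R u v"
  shows "wcong R (winv u) (winv v)"
proof -
  have "wcong R (winv u) (winv u @ v @ winv v)"
    using wcong_cancel_right[of R "winv u" v "[]"] wcong.sym by simp
  also have "wcong R \<dots> (winv u @ u @ winv v)"
    by (rule wcong.ctx[OF wcong.sym[OF assms]])
  also have "wcong R \<dots> (winv v)"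
    using wcong_cancel_left[of R "[]" u "winv v"] by simp
  finally show ?thesis .
qed

lemma wcong_conj_append:
  "wcong R (winv g @ (u @ v) @ g) ((winv g @ u @ g) @ (winv g @ v @ g))"
  using wcong.sym[OF wcong_cancel_right[of R "winv g @ u" g "v @ g"]] by simp

text \<open>A commutator with a trivial entry is trivial, and this propagates outward through the
  nesting. It makes the killing of letters effective: a commutator containing a killed letter
  disappears.\<close>

lemma wcong_lcomm_Nil: "[] \<in> set us \<Longrightarrow> wcong R (lcomm us) []"
proof (induction us rule: rev_induct)
  case (snoc u us)
  show ?case
  proof (cases "us = []")
    case False
    show ?thesis
    proof (cases "u = []")
      case True
      then show ?thesis using False by (simp add: lcomm_snoc wcomm_def wcong_inv_left)
    next
      case u: False
      with snoc have e: "wcong R (lcomm us) []" by auto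
      have "wcong R (winv (lcomm us) @ winv u @ lcomm us @ u) (winv [] @ winv u @ [] @ u)"
        by (intro wcong_append wcong_winv e wcong.refl)
      also have "wcong R \<dots> []" by (simp add: wcong_inv_left)
      finally show ?thesis using False by (simp add: lcomm_snoc wcomm_def)
    qed
  qed (use snoc in \<open>simp add: wcong.refl\<close>)
qed simp

lemma concat_replicate_snoc: "concat (replicate n y) @ y = y @ concat (replicate n y)"
  by (induction n) auto

lemma wcong_wpow_snoc: "wcong R (wpow y e @ y) (wpow y (e + 1))"
proof (cases "0 \<le> e")
  case True
  then have "nat (e + 1) = Suc (nat e)" by simp
  then show ?thesis using True
    by (simp add: wpow_def wcong.refl concat_replicate_snoc)
next
  case False
  then have n: "nat (- e) = Suc (nat (- e - 1))" by simp
  have "wcong R (wpow y e @ y) (concat (replicate (nat (- e - 1)) (winv y)))"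
    using False wcong_cancel_left[of R "concat (replicate (nat (- e - 1)) (winv y))" y "[]"]
    by (simp add: wpow_def n concat_replicate_snoc[symmetric])
  \<comment> \<open>At \<open>e = -1\<close> the exponent \<open>e + 1\<close> is 0 and
    \<open>wpow\<close> switches to its nonnegative branch; both sides are then empty.\<close>
  also have "concat (replicate (nat (- e - 1)) (winv y)) = wpow y (e + 1)"
    using False by (cases "e = - 1") (auto simp: wpow_def)
  finally show ?thesis .
qed

lemma wcong_wpow_snoc_winv: "wcong R (wpow y e @ winv y) (wpow y (e - 1))"
proof -
  have "wcong R (wpow y e @ winv y) (wpow y (e - 1) @ y @ winv y)"
    using wcong_append[OF wcong.sym[OF wcong_wpow_snoc[of R y "e - 1"]] wcong.refl[of R "winv y"]]
    by simp
  also have "wcong R \<dots> (wpow y (e - 1))"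
    using wcong_cancel_right[of R "wpow y (e - 1)" y "[]"] by simp
  finally show ?thesis .
qed

lemma wprod_Cons [simp]: "wprod (y # ys) (e # es) = wpow y e @ wprod ys es"
  and wprod_Nil [simp]: "wprod [] es = []"
  by (simp_all add: wprod_def)

lemma wprod_append:
  "length ys = length es \<Longrightarrow> wprod (ys @ ys') (es @ es') = wprod ys es @ wprod ys' es'"
  by (simp add: wprod_def)

section \<open>Substitutions\<close>

definition subst :: "(nat \<Rightarrow> word) \<Rightarrow> word \<Rightarrow> word" where
  "subst f w = concat (map (\<lambda>(a, s). if s then f a else winv (f a)) w)"

lemma subst_Nil [simp]: "subst f [] = []"
  and subst_append [simp]: "subst f (u @ v) = subst f u @ subst f v"
  by (simp_all add: subst_def)

lemma subst_single: "subst f [l] = (if snd l then f (fst l) else winv (f (fst l)))"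
  by (simp add: subst_def case_prod_beta)

lemma subst_winv [simp]: "subst f (winv w) = winv (subst f w)"
proof (induction w)
  case (Cons l w)
  then show ?case
    using subst_append[of f "[l]" w] by (auto simp: winv_Cons subst_single)
qed simp

lemma subst_lcomm: "subst f (lcomm us) = lcomm (map (subst f) us)"
proof (induction us rule: rev_induct)
  case (snoc u us)
  then show ?case by (cases "us = []") (simp_all add: lcomm_snoc wcomm_def)
qed simp

lemma over_subst: "over r w \<Longrightarrow> (\<And>a. a < r \<Longrightarrow> over s (f a)) \<Longrightarrow> over s (subst f w)"
  by (auto simp: subst_def over_concat over_def[of r] split: prod.splits)

text \<open>Substitution is a homomorphism, so it maps left-normed commutators to left-normed
  commutators. As relators admit arbitrary words as entries, the image of a relator is again a
  relator, with no injectivity needed and for any two ranks.\<close>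

lemma nil_eq_subst:
  assumes "nil_eq r c u v" and f: "\<And>a. a < r \<Longrightarrow> over s (f a)"
  shows "nil_eq s c (subst f u) (subst f v)"
  using assms(1) unfolding nil_eq_def
proof (induction rule: wcong.induct)
  case (cancel i b)
  show ?case
    using subst_append[of f "[(i, b)]" "[(i, \<not> b)]"]
    by (auto simp: subst_single wcong_inv_left wcong_inv_right)
next
  case (rel u)
  then obtain us where us: "u = lcomm us" "length us = Suc c" "\<forall>x \<in> set us. over r x"
    by (auto simp: comm_relators_def)
  then have "subst f u \<in> comm_relators s (Suc c)"
    unfolding comm_relators_def using over_subst[of r _ s f, OF _ f]
    by (auto simp: subst_lcomm intro!: exI[of _ "map (subst f) us"])
  then show ?case by (simp add: wcong.rel)
qed (auto intro: wcong.intros simp del: append_assoc)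

text \<open>Combines a retraction onto some letters with a renaming of them. It serves both to
  discard letters outside the alphabet and to carry relations from one rank to another.\<close>

definition restrict_letters :: "nat set \<Rightarrow> (nat \<Rightarrow> nat) \<Rightarrow> nat \<Rightarrow> word" where
  "restrict_letters S p a = (if a \<in> S then [(p a, True)] else [])"

lemma subst_restrict_id: "fst ` set w \<subseteq> S \<Longrightarrow> subst (restrict_letters S p) w = map (apfst p) w"
  by (induction w) (auto simp: subst_def restrict_letters_def)

lemma subst_retract: "over r w \<Longrightarrow> subst (restrict_letters {..<r} (\<lambda>a. a)) w = w"
  by (subst subst_restrict_id) (auto simp: over_def apfst_def map_prod_def)

section \<open>Signed iterated commutators of letters\<close>

type_synonym item = "letter list \<times> bool"

abbreviation letter_comm :: "letter list \<Rightarrow> word" where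
  "letter_comm as \<equiv> lcomm (map (\<lambda>l. [l]) as)"

abbreviation wt :: "item \<Rightarrow> nat" where
  "wt it \<equiv> length (fst it)"

definition ival :: "item \<Rightarrow> word" where
  "ival it = (if snd it then letter_comm (fst it) else winv (letter_comm (fst it)))"

definition iprod :: "item list \<Rightarrow> word" where
  "iprod zs = concat (map ival zs)"

definition iinv :: "item \<Rightarrow> item" where
  "iinv it = (fst it, \<not> snd it)"

text \<open>The bound \<open>1 \<le> wt it\<close> excludes the empty letter list even for
  \<open>k = 0\<close>. For \<open>k > c\<close> the set is empty, which is how the collection
  terminates.\<close>

definition items :: "nat \<Rightarrow> nat \<Rightarrow> nat \<Rightarrow> item set" where
  "items r c k = {it. over r (fst it) \<and> 1 \<le> wt it \<and> k \<le> wt it \<and> wt it \<le> c}"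

lemma iprod_simps [simp]: "iprod [] = []" "iprod (z # zs) = ival z @ iprod zs"
  "iprod (xs @ zs) = iprod xs @ iprod zs"
  by (simp_all add: iprod_def)

lemma ival_iinv [simp]: "ival (iinv z) = winv (ival z)"
  by (simp add: ival_def iinv_def)

lemma fst_iinv [simp]: "fst (iinv z) = fst z"
  by (simp add: iinv_def)

lemma iinv_in_items [simp]: "iinv z \<in> items r c k \<longleftrightarrow> z \<in> items r c k"
  by (simp add: items_def)

lemma winv_iprod: "winv (iprod zs) = iprod (rev (map iinv zs))"
  by (induction zs) auto

lemma items_antimono: "j \<le> k \<Longrightarrow> items r c k \<subseteq> items r c j"
  by (auto simp: items_def)

lemma over_letter_comm: "over r as \<Longrightarrow> over r (letter_comm as)"
  by (rule over_lcomm) (simp add: over_def)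

lemma over_ival: "z \<in> items r c k \<Longrightarrow> over r (ival z)"
  by (simp add: items_def ival_def over_letter_comm)

lemma over_iprod: "set zs \<subseteq> items r c k \<Longrightarrow> over r (iprod zs)"
  by (induction zs) (auto simp: over_ival)

lemma length_letter_comm: "length (letter_comm as) \<le> 4 ^ length as"
proof (induction as rule: rev_induct)
  case (snoc l as)
  show ?case
  proof (cases "as = []")
    case False
    have "(1::nat) \<le> 4 ^ length as" by simp
    moreover have "length (letter_comm (as @ [l])) = 2 * length (letter_comm as) + 2"
      using False by (simp add: lcomm_snoc wcomm_def)
    ultimately show ?thesis using snoc unfolding length_append_singleton power_Suc by linarith
  qed simp
qed simp

lemma length_ival:
  assumes "z \<in> items r c k"
  shows "length (ival z) \<le> 4 ^ c"
proof -
  have "length (ival z) \<le> 4 ^ wt z" by (simp add: ival_def length_letter_comm)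
  also have "\<dots> \<le> (4::nat) ^ c" using assms by (intro power_increasing) (auto simp: items_def)
  finally show ?thesis .
qed

section \<open>Conjugating a letter commutator by a word\<close>

context
  fixes r c :: nat
begin

abbreviation eqv :: "word \<Rightarrow> word \<Rightarrow> bool" (infix "\<approx>" 50) where
  "u \<approx> v \<equiv> wcong (comm_relators r (Suc c)) u v"

text \<open>By \<open>x^l = x [x,l]\<close> and its inverse \<open>(x^-1)^l = [x,l]^-1 x^-1\<close>,
  the new commutator inherits the sign of the old one and stands to its right or left
  accordingly.\<close>

lemma conj_item_letter:
  assumes "z \<in> items r c k" "fst l < r"
  shows "\<exists>xs ys. winv [l] @ ival z @ [l] \<approx> iprod (xs @ [z] @ ys) \<and>
           set (xs @ ys) \<subseteq> items r c (Suc (wt z)) \<and> length (xs @ ys) \<le> 1"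
proof -
  define as where "as = fst z"
  define new where "new = (as @ [l], snd z)"
  have as: "as \<noteq> []" using assms by (auto simp: items_def as_def)
  have pos: "winv [l] @ letter_comm as @ [l] \<approx> letter_comm as @ letter_comm (as @ [l])"
    using wcong.sym[OF wcong_cancel_right[of _ "[]" "letter_comm as" "winv [l] @ letter_comm as @ [l]"]]
      as by (simp add: lcomm_snoc wcomm_def)
  have neg: "winv [l] @ winv (letter_comm as) @ [l] \<approx> winv (letter_comm (as @ [l])) @ winv (letter_comm as)"
    using wcong_winv[OF pos] by (simp add: winv_Cons)
  have eq: "winv [l] @ ival z @ [l] \<approx> (if snd z then ival z @ ival new else ival new @ ival z)"
    using pos neg by (auto simp: ival_def new_def as_def)
  show ?thesis
  proof (cases "wt z < c")
    case True
    then have "new \<in> items r c (Suc (wt z))"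
      using assms by (auto simp: items_def new_def as_def)
    then have "winv [l] @ ival z @ [l] \<approx> iprod ((if snd z then [] else [new]) @ [z] @ (if snd z then [new] else []))"
      "set ((if snd z then [] else [new]) @ (if snd z then [new] else [])) \<subseteq> items r c (Suc (wt z))"
      "length ((if snd z then [] else [new]) @ (if snd z then [new] else [])) \<le> 1"
      using eq by auto
    then show ?thesis by blast
  next
    case False
    \<comment> \<open>Here the new commutator has weight \<open>c + 1\<close>, so it is a relator
      and no new factor appears.\<close>
    have "length (map (\<lambda>l. [l]) (as @ [l])) = Suc c" "\<forall>u \<in> set (map (\<lambda>l. [l]) (as @ [l])). over r u"
      using assms False by (force simp: items_def as_def over_def)+
    then have "letter_comm (as @ [l]) \<in> comm_relators r (Suc c)"
      unfolding comm_relators_def by blast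
    then have "letter_comm (as @ [l]) \<approx> []" by (rule wcong.rel)
    with wcong_winv[OF this] have new: "ival new \<approx> []" by (simp add: ival_def new_def)
    have "winv [l] @ ival z @ [l] \<approx> ival z"
      using wcong.trans[OF eq] wcong_append[OF new wcong.refl[of _ "ival z"]]
        wcong_append[OF wcong.refl[of _ "ival z"] new] by (auto split: if_splits)
    then show ?thesis by (intro exI[of _ "[]"]) auto
  qed
qed

text \<open>Each letter of the conjugator at most doubles the number of factors, so there are at
  most \<open>2 ^ length g\<close> in all. The original \<open>z\<close> is one of them, whence the
  strict bound on the new ones.\<close>

lemma conj_item:
  assumes "z \<in> items r c k" "over r g"
  shows "\<exists>xs ys. winv g @ ival z @ g \<approx> iprod (xs @ [z] @ ys) \<and>
           set (xs @ ys) \<subseteq> items r c (Suc (wt z)) \<and> length (xs @ ys) < 2 ^ length g"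
  using assms
proof (induction g arbitrary: z k)
  case Nil
  then show ?case by (intro exI[of _ "[]"]) (auto intro: wcong.refl)
next
  case (Cons l g)
  from Cons.prems have l: "fst l < r" and g: "over r g" by auto
  from conj_item_letter[OF Cons.prems(1) l] obtain xs ys where
    xy: "winv [l] @ ival z @ [l] \<approx> iprod (xs @ [z] @ ys)"
      "set (xs @ ys) \<subseteq> items r c (Suc (wt z))" "length (xs @ ys) \<le> 1" by blast
  from Cons.IH[OF Cons.prems(1) g] obtain xs' ys' where
    xy': "winv g @ ival z @ g \<approx> iprod (xs' @ [z] @ ys')"
      "set (xs' @ ys') \<subseteq> items r c (Suc (wt z))" "length (xs' @ ys') < 2 ^ length g" by blast
  \<comment> \<open>The extra factor created by \<open>l\<close> must itself be conjugated by
    \<open>g\<close>; counting that factor too, the induction hypothesis gives at most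
    \<open>2 ^ length g\<close> factors.\<close>
  have new: "\<exists>ns. winv g @ iprod vs @ g \<approx> iprod ns \<and> set ns \<subseteq> items r c (Suc (wt z))
      \<and> length ns \<le> length vs * 2 ^ length g"
    if "set vs \<subseteq> items r c (Suc (wt z))" "length vs \<le> 1" for vs
  proof (cases vs)
    case Nil
    then show ?thesis using wcong_inv_left by (intro exI[of _ "[]"]) auto
  next
    case (Cons n vs')
    then have n: "n \<in> items r c (Suc (wt z))" "vs = [n]" using that by auto
    from Cons.IH[OF n(1) g] obtain ps qs where
      "winv g @ ival n @ g \<approx> iprod (ps @ [n] @ qs)"
      "set (ps @ qs) \<subseteq> items r c (Suc (wt n))" "length (ps @ qs) < 2 ^ length g" by blast
    moreover have "items r c (Suc (wt n)) \<subseteq> items r c (Suc (wt z))"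
      using n(1) by (intro items_antimono) (auto simp: items_def)
    ultimately show ?thesis using n by (intro exI[of _ "ps @ [n] @ qs"]) auto
  qed
  from new[of xs] xy obtain nx where nx: "winv g @ iprod xs @ g \<approx> iprod nx"
    "set nx \<subseteq> items r c (Suc (wt z))" "length nx \<le> length xs * 2 ^ length g" by auto
  from new[of ys] xy obtain ny where ny: "winv g @ iprod ys @ g \<approx> iprod ny"
    "set ny \<subseteq> items r c (Suc (wt z))" "length ny \<le> length ys * 2 ^ length g" by auto
  have "winv (l # g) @ ival z @ (l # g) = winv g @ (winv [l] @ ival z @ [l]) @ g"
    by (simp add: winv_Cons)
  also have "\<dots> \<approx> winv g @ iprod (xs @ [z] @ ys) @ g" by (rule wcong.ctx[OF xy(1)])
  also have "iprod (xs @ [z] @ ys) = iprod xs @ ival z @ iprod ys" by simp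
  also have "winv g @ \<dots> @ g \<approx> (winv g @ iprod xs @ g) @ (winv g @ (ival z @ iprod ys) @ g)"
    by (rule wcong_conj_append)
  also have "\<dots> \<approx> (winv g @ iprod xs @ g) @ ((winv g @ ival z @ g) @ (winv g @ iprod ys @ g))"
    by (intro wcong_append wcong.refl wcong_conj_append)
  also have "\<dots> \<approx> iprod nx @ (iprod (xs' @ [z] @ ys') @ iprod ny)"
    by (intro wcong_append nx ny xy')
  also have "\<dots> = iprod ((nx @ xs') @ [z] @ (ys' @ ny))" by simp
  finally have 1: "winv (l # g) @ ival z @ (l # g) \<approx> \<dots>" .
  have "length (nx @ ny) \<le> length (xs @ ys) * 2 ^ length g"
    using nx(3) ny(3) by (simp add: add_mult_distrib)
  also have "\<dots> \<le> 1 * 2 ^ length g" using xy(3) by (intro mult_right_mono) auto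
  finally have 2: "length ((nx @ xs') @ (ys' @ ny)) < 2 ^ length (l # g)" using xy'(3) by simp
  from 1 2 show ?case using nx(2) ny(2) xy'(2)
    by (intro exI[of _ "nx @ xs'"] exI[of _ "ys' @ ny"] conjI) auto
qed

section \<open>The lower central series through iterated commutators of letters\<close>

text \<open>The term gamma_j of the lower central series of N_(r,c), presented through letter
  commutators of weight at least j. The lemmas that follow show that it is a normal subgroup
  containing every left-normed commutator of j arbitrary words.\<close>

definition gam :: "nat \<Rightarrow> word set" where
  "gam j = {w. \<exists>zs. set zs \<subseteq> items r c j \<and> w \<approx> iprod zs}"

lemma gamI: "set zs \<subseteq> items r c j \<Longrightarrow> w \<approx> iprod zs \<Longrightarrow> w \<in> gam j"
  by (auto simp: gam_def)

lemma gam_Nil: "[] \<in> gam j"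
  by (rule gamI[of "[]"]) (auto intro: wcong.refl)

lemma gam_append:
  assumes "u \<in> gam j" "v \<in> gam j"
  shows "u @ v \<in> gam j"
proof -
  from assms obtain zs zs' where "set zs \<subseteq> items r c j" "u \<approx> iprod zs"
    "set zs' \<subseteq> items r c j" "v \<approx> iprod zs'" by (auto simp: gam_def)
  then show ?thesis using wcong_append[of _ u "iprod zs" v "iprod zs'"]
    by (intro gamI[of "zs @ zs'"]) auto
qed

lemma gam_winv:
  assumes "u \<in> gam j"
  shows "winv u \<in> gam j"
proof -
  from assms obtain zs where "set zs \<subseteq> items r c j" "u \<approx> iprod zs" by (auto simp: gam_def)
  then show ?thesis using wcong_winv[of _ u "iprod zs"]
    by (intro gamI[of "rev (map iinv zs)"]) (auto simp: winv_iprod)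
qed

lemma gam_cong: "u \<approx> v \<Longrightarrow> v \<in> gam j \<Longrightarrow> u \<in> gam j"
  unfolding gam_def using wcong.trans by blast

lemma gam_iprod: "set zs \<subseteq> items r c j \<Longrightarrow> iprod zs \<in> gam j"
  by (rule gamI) (auto intro: wcong.refl)

lemma gam_conj:
  assumes "u \<in> gam j" "over r g"
  shows "winv g @ u @ g \<in> gam j"
proof -
  from assms obtain zs where zs: "set zs \<subseteq> items r c j" "u \<approx> iprod zs" by (auto simp: gam_def)
  have "winv g @ iprod zs @ g \<in> gam j" using zs(1)
  proof (induction zs)
    case Nil
    show ?case using gam_cong[OF wcong_inv_left gam_Nil] by simp
  next
    case (Cons z zs)
    from Cons.prems have z: "z \<in> items r c j" by simp
    from conj_item[OF z assms(2)] obtain xs ys where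
      xy: "winv g @ ival z @ g \<approx> iprod (xs @ [z] @ ys)"
        "set (xs @ ys) \<subseteq> items r c (Suc (wt z))" by blast
    have "items r c (Suc (wt z)) \<subseteq> items r c j"
      using z by (intro items_antimono) (auto simp: items_def)
    then have "winv g @ ival z @ g \<in> gam j"
      using xy z by (intro gamI[OF _ xy(1)]) auto
    with Cons show ?case
      using gam_cong[OF wcong_conj_append[of _ g "ival z" "iprod zs"] gam_append] by simp
  qed
  then show ?thesis by (rule gam_cong[OF wcong.ctx[OF zs(2)]])
qed

lemma gam_wcomm_iprod:
  assumes "set zs \<subseteq> items r c j" "over r g"
  shows "wcomm (iprod zs) g \<in> gam (Suc j)"
  using assms(1)
proof (induction zs)
  case Nil
  show ?case using gam_cong[OF wcong_inv_left gam_Nil] by (simp add: wcomm_def)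
next
  case (Cons z zs)
  from Cons.prems have z: "z \<in> items r c j" by simp
  from conj_item[OF z assms(2)] obtain xs ys where
    xy: "winv g @ ival z @ g \<approx> iprod (xs @ [z] @ ys)"
      "set (xs @ ys) \<subseteq> items r c (Suc (wt z))" by blast
  have "items r c (Suc (wt z)) \<subseteq> items r c (Suc j)"
    using z by (intro items_antimono) (auto simp: items_def)
  with xy(2) have sub: "set xs \<subseteq> items r c (Suc j)" "set ys \<subseteq> items r c (Suc j)" by auto
  have "wcomm (ival z) g \<approx> winv (ival z) @ iprod (xs @ [z] @ ys)"
    unfolding wcomm_def using wcong_append[OF wcong.refl xy(1), of "winv (ival z)"] by simp
  \<comment> \<open>In \<open>[z,g] = z^-1 z^g\<close> the factor \<open>z\<close> cancels at the
    price of conjugating \<open>xs\<close> by it, which \<open>gam_conj\<close> absorbs.\<close>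
  also have "\<dots> = (winv (ival z) @ iprod xs @ ival z) @ iprod ys" by simp
  finally have "wcomm (ival z) g \<in> gam (Suc j)"
    by (rule gam_cong) (intro gam_append gam_conj gam_iprod sub over_ival[OF z])
  moreover have "over r (iprod zs)" using Cons.prems by (intro over_iprod) auto
  ultimately have 1: "winv (iprod zs) @ wcomm (ival z) g @ iprod zs \<in> gam (Suc j)"
    by (rule gam_conj)
  text \<open>The identity [xy,g] = [x,g]^y [y,g].\<close>
  have "wcomm (iprod (z # zs)) g \<approx> (winv (iprod zs) @ wcomm (ival z) g @ iprod zs) @ wcomm (iprod zs) g"
  proof -
    have "wcomm (iprod (z # zs)) g = (winv (iprod zs) @ winv (ival z) @ winv g @ ival z) @ iprod zs @ g"
      by (simp add: wcomm_def)
    also have "\<dots> \<approx> (winv (iprod zs) @ winv (ival z) @ winv g @ ival z) @ g @ winv g @ iprod zs @ g"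
      by (rule wcong.sym[OF wcong_cancel_right])
    also have "\<dots> = (winv (iprod zs) @ winv (ival z) @ winv g @ ival z @ g) @ winv g @ iprod zs @ g"
      by simp
    also have "\<dots> \<approx> (winv (iprod zs) @ winv (ival z) @ winv g @ ival z @ g) @
        iprod zs @ winv (iprod zs) @ winv g @ iprod zs @ g"
      by (rule wcong.sym[OF wcong_cancel_right])
    finally show ?thesis by (simp add: wcomm_def)
  qed
  then show ?case using Cons by (rule_tac gam_cong[OF _ gam_append[OF 1]]) auto
qed

lemma gam_wcomm:
  assumes "u \<in> gam j" "over r g"
  shows "wcomm u g \<in> gam (Suc j)"
proof -
  from assms obtain zs where zs: "set zs \<subseteq> items r c j" "u \<approx> iprod zs" by (auto simp: gam_def)
  have "wcomm u g \<approx> wcomm (iprod zs) g"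
    unfolding wcomm_def by (intro wcong_append wcong_winv wcong.refl zs)
  then show ?thesis using gam_wcomm_iprod[OF zs(1) assms(2)] by (rule gam_cong)
qed

lemma over_as_iprod:
  assumes "over r w" "1 \<le> c"
  shows "\<exists>zs. set zs \<subseteq> items r c 1 \<and> iprod zs = w \<and> length zs = length w"
  using assms(1)
proof (induction w)
  case (Cons l w)
  then obtain zs where "set zs \<subseteq> items r c 1" "iprod zs = w" "length zs = length w" by auto
  moreover have "([l], True) \<in> items r c 1" "ival ([l], True) = [l]"
    using Cons.prems assms(2) by (auto simp: items_def ival_def)
  ultimately show ?case by (intro exI[of _ "([l], True) # zs"]) auto
qed simp

lemma gam_lcomm:
  assumes "1 \<le> c" "us \<noteq> []" "\<forall>u \<in> set us. over r u"
  shows "lcomm us \<in> gam (length us)"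
  using assms(2-)
proof (induction us rule: rev_induct)
  case (snoc u us)
  show ?case
  proof (cases "us = []")
    case True
    from snoc obtain zs where "set zs \<subseteq> items r c 1" "iprod zs = u"
      using over_as_iprod[OF _ assms(1)] by auto
    then show ?thesis using gam_iprod[of zs 1] True by simp
  qed (use snoc gam_wcomm in \<open>simp add: lcomm_snoc\<close>)
qed simp

text \<open>A derivation of \<open>nil_eq\<close> may pass through words with letters of index at
  least r, and conjugation by these is not covered by \<open>gam_conj\<close>. The retraction
  removes them and fixes all words over r.\<close>

abbreviation ret :: "word \<Rightarrow> word" where
  "ret \<equiv> subst (restrict_letters {..<r} (\<lambda>a. a))"

lemma over_ret: "over r (ret w)"
proof (induction w)
  case (Cons l w)
  have "over r (ret [l])" by (simp add: subst_single restrict_letters_def)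
  with Cons show ?case using subst_append[of _ "[l]" w] by simp
qed simp

text \<open>Bridges two quotients: a layer basis is given modulo gamma_(k+1), whereas collection
  takes place modulo gamma_(c+1). The discrepancy is a product of heavier commutators, left to later
  stages. In the induction it is kept at the right end by conjugating it past the context.\<close>

lemma nil_eq_lower_class:
  assumes "nil_eq r k u v" "1 \<le> c"
  shows "\<exists>h \<in> gam (Suc k). ret u \<approx> ret v @ h"
  using assms(1) unfolding nil_eq_def
proof (induction rule: wcong.induct)
  case (refl w)
  show ?case using gam_Nil by (intro bexI[of _ "[]"]) (simp_all add: wcong.refl)
next
  case (sym w v)
  then obtain h where h: "h \<in> gam (Suc k)" "ret w \<approx> ret v @ h" by blast
  have "ret w @ winv h \<approx> (ret v @ h) @ winv h" by (intro wcong_append h wcong.refl)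
  also have "\<dots> \<approx> ret v" using wcong_cancel_right[of _ "ret v" h "[]"] by simp
  finally show ?case using h gam_winv wcong.sym by blast
next
  case (trans u v w)
  then obtain h h' where h: "h \<in> gam (Suc k)" "ret u \<approx> ret v @ h"
    "h' \<in> gam (Suc k)" "ret v \<approx> ret w @ h'" by blast
  have "ret v @ h \<approx> (ret w @ h') @ h" by (intro wcong_append h wcong.refl)
  with h(2) have "ret u \<approx> ret w @ h' @ h" using wcong.trans by simp
  then show ?case using h gam_append by blast
next
  case (ctx w v a b)
  then obtain h where h: "h \<in> gam (Suc k)" "ret w \<approx> ret v @ h" by blast
  have "ret a @ ret w @ ret b \<approx> ret a @ (ret v @ h) @ ret b" by (rule wcong.ctx[OF h(2)])
  also have "\<dots> = (ret a @ ret v) @ h @ ret b" by simp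
  also have "\<dots> \<approx> (ret a @ ret v) @ ret b @ winv (ret b) @ h @ ret b"
    by (rule wcong.sym[OF wcong_cancel_right])
  finally show ?case 
    using gam_conj[OF h(1) over_ret[of b]] by (auto intro: bexI[of _ "winv (ret b) @ h @ ret b"])
next
  case (cancel i s)
  have "ret [(i, s), (i, \<not> s)] \<approx> []"
    using subst_append[of _ "[(i, s)]" "[(i, \<not> s)]"]
    by (auto simp: subst_single wcong_inv_left wcong_inv_right)
  then show ?case using gam_Nil by (intro bexI[of _ "[]"]) simp_all
next
  case (rel u)
  then obtain us where us: "u = lcomm us" "length us = Suc k" "\<forall>x \<in> set us. over r x"
    by (auto simp: comm_relators_def)
  then have "ret u = u" by (simp add: over_lcomm subst_retract)
  moreover have "u \<in> gam (Suc k)" using gam_lcomm[OF assms(2), of us] us by (cases us) simp_all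
  ultimately show ?case by (intro bexI[of _ u]) (simp_all add: wcong.refl)
qed

section \<open>Collection\<close>

abbreviation level :: "nat \<Rightarrow> item list \<Rightarrow> item list" where
  "level k us \<equiv> filter (\<lambda>z. wt z = k) us"

definition cost :: "real \<Rightarrow> item list \<Rightarrow> real" where
  "cost E us = (\<Sum>u\<leftarrow>us. E ^ (c - wt u))"

lemma cost_simps [simp]: "cost E [] = 0" "cost E (u # us) = E ^ (c - wt u) + cost E us"
  "cost E (us @ vs) = cost E us + cost E vs"
  by (simp_all add: cost_def)

lemma cost_nonneg: "1 \<le> E \<Longrightarrow> 0 \<le> cost E us"
  by (induction us) auto

lemma length_le_cost: "1 \<le> E \<Longrightarrow> real (length us) \<le> cost E us"
  by (induction us) (auto intro: add_mono one_le_power)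

lemma cost_le_items:
  assumes "1 \<le> E" "set us \<subseteq> items r c j"
  shows "cost E us \<le> real (length us) * E ^ (c - j)"
  using assms(2)
proof (induction us)
  case (Cons u us)
  have "E ^ (c - wt u) \<le> E ^ (c - j)"
    using Cons.prems assms(1) by (intro power_increasing) (auto simp: items_def)
  then show ?case using Cons by (simp add: algebra_simps)
qed simp

text \<open>Bounds the factors that one conjugation adds per factor: the conjugator is a commutator
  of weight at most \<open>c\<close>, hence of length at most \<open>4 ^ c\<close>, and
  \<open>conj_item\<close> contributes the power of two.\<close>

abbreviation growth :: real where
  "growth \<equiv> 2 ^ 4 ^ c"

text \<open>A factor of cost \<open>E ^ (c - j)\<close> gives rise to fewer than
  \<open>growth\<close> new ones, each costing at most 1/E times as much. All of them are heavier,
  so the sublist of weight \<open>k\<close> stays as it was.\<close>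

lemma conj_iprod:
  assumes E: "1 \<le> E" and g: "over r g" "length g \<le> 4 ^ c" and us: "set us \<subseteq> items r c k"
  shows "\<exists>us'. winv g @ iprod us @ g \<approx> iprod us' \<and> set us' \<subseteq> items r c k \<and>
           level k us' = level k us \<and> cost E us' \<le> (1 + growth / E) * cost E us"
  using us
proof (induction us)
  case Nil
  show ?case by (rule exI[of _ "[]"]) (simp add: wcong_inv_left)
next
  case (Cons u us)
  then obtain us' where us': "winv g @ iprod us @ g \<approx> iprod us'" "set us' \<subseteq> items r c k"
    "level k us' = level k us" "cost E us' \<le> (1 + growth / E) * cost E us" by auto
  from Cons.prems have u: "u \<in> items r c k" by simp
  from conj_item[OF u g(1)] obtain xs ys where
    xy: "winv g @ ival u @ g \<approx> iprod (xs @ [u] @ ys)"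
      "set (xs @ ys) \<subseteq> items r c (Suc (wt u))" "length (xs @ ys) < 2 ^ length g" by blast
  have high: "items r c (Suc (wt u)) \<subseteq> items r c (Suc k)"
    using u by (intro items_antimono) (auto simp: items_def)
  then have lev: "level k xs = []" "level k ys = []"
    using xy(2) by (auto simp: filter_empty_conv items_def)
  have new: "cost E (xs @ ys) \<le> growth / E * E ^ (c - wt u)"
  proof (cases "xs @ ys = []")
    case False
    then obtain n where "n \<in> items r c (Suc (wt u))" using xy(2) by (cases "xs @ ys") auto
    \<comment> \<open>The truncated difference \<open>c - wt u\<close> is positive as soon as a new
      factor exists, so the cost really drops by a factor of E.\<close>
    then have "wt u < c" by (auto simp: items_def)
    then have "c - wt u = Suc (c - Suc (wt u))" by simp
    then have pow: "growth / E * E ^ (c - wt u) = growth * E ^ (c - Suc (wt u))" using E by simp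
    have "(2::nat) ^ length g \<le> 2 ^ 4 ^ c" using g(2) by (rule power_increasing) simp
    with xy(3) have "length (xs @ ys) \<le> 2 ^ 4 ^ c" by linarith
    then have "real (length (xs @ ys)) \<le> real (2 ^ 4 ^ c)" by (rule of_nat_mono)
    then have "real (length (xs @ ys)) \<le> growth" by simp
    then have "real (length (xs @ ys)) * E ^ (c - Suc (wt u)) \<le> growth * E ^ (c - Suc (wt u))"
      using E by (intro mult_right_mono) auto
    with cost_le_items[OF E xy(2)] show ?thesis unfolding pow by (rule order_trans)
  qed (use E in simp)
  have "winv g @ iprod (u # us) @ g \<approx> (winv g @ ival u @ g) @ (winv g @ iprod us @ g)"
    using wcong_conj_append[of _ g "ival u" "iprod us"] by simp
  also have "\<dots> \<approx> iprod (xs @ [u] @ ys) @ iprod us'" by (intro wcong_append xy us')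
  also have "\<dots> = iprod ((xs @ [u] @ ys) @ us')" by simp
  finally have 1: "winv g @ iprod (u # us) @ g \<approx> \<dots>" .
  have 2: "set ((xs @ [u] @ ys) @ us') \<subseteq> items r c k"
    using xy(2) high items_antimono[of k "Suc k" r c] u us'(2) by auto
  have 3: "level k ((xs @ [u] @ ys) @ us') = level k (u # us)" using lev us'(3) by simp
  have 4: "cost E ((xs @ [u] @ ys) @ us') \<le> (1 + growth / E) * cost E (u # us)"
  proof -
    define d where "d = growth / E"
    show ?thesis using new us'(4) unfolding d_def[symmetric] by (simp add: algebra_simps)
  qed
  from 1 2 3 4 show ?case by blast
qed

text \<open>The list is read from left to right. When \<open>u\<close> equals \<open>y\<close> or
  its inverse, it is moved past the remainder by \<open>v u = u v^u\<close> and merged into the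
  power in front. As conjugation leaves the weight-k sublist unchanged, there is exactly one move
  per original occurrence.\<close>

lemma extract_power:
  assumes E: "1 \<le> E" and us: "set us \<subseteq> items r c k"
  shows "\<exists>e us'. iprod us \<approx> wpow y e @ iprod us' \<and> set us' \<subseteq> items r c k \<and>
           level k us' = filter (\<lambda>z. ival z \<notin> {y, winv y}) (level k us) \<and>
           \<bar>e\<bar> \<le> int (length (filter (\<lambda>z. ival z \<in> {y, winv y}) (level k us))) \<and>
           cost E us' \<le> (1 + growth / E) ^ length (filter (\<lambda>z. ival z \<in> {y, winv y}) (level k us)) * cost E us"
  using us
proof (induction us rule: rev_induct)
  case Nil
  show ?case by (rule exI[of _ 0], rule exI[of _ "[]"]) (simp add: wpow_def wcong.refl)
next
  case (snoc u us)
  define t where "t = length (filter (\<lambda>z. ival z \<in> {y, winv y}) (level k us))"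
  from snoc obtain e us' where IH: "iprod us \<approx> wpow y e @ iprod us'" "set us' \<subseteq> items r c k"
    "level k us' = filter (\<lambda>z. ival z \<notin> {y, winv y}) (level k us)" "\<bar>e\<bar> \<le> int t"
    "cost E us' \<le> (1 + growth / E) ^ t * cost E us" unfolding t_def by auto
  from snoc.prems have u: "u \<in> items r c k" by simp
  have q: "1 \<le> 1 + growth / E" using E by simp
  have prod: "iprod (us @ [u]) \<approx> (wpow y e @ iprod us') @ ival u"
    using wcong_append[OF IH(1) wcong.refl[of _ "ival u"]] by simp
  show ?case
  proof (cases "wt u = k \<and> ival u \<in> {y, winv y}")
    case True
    from conj_iprod[OF E over_ival[OF u] length_ival[OF u] IH(2)] obtain us'' where
      us'': "winv (ival u) @ iprod us' @ ival u \<approx> iprod us''" "set us'' \<subseteq> items r c k"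
        "level k us'' = level k us'" "cost E us'' \<le> (1 + growth / E) * cost E us'" by blast
    \<comment> \<open>The number \<open>d\<close> is the sign with which \<open>y\<close>
      occurs.\<close>
    have "\<exists>d. \<bar>d\<bar> \<le> 1 \<and> wpow y e @ ival u \<approx> wpow y (e + d)"
    proof (cases "ival u = y")
      case True
      then show ?thesis using wcong_wpow_snoc by (intro exI[of _ 1]) auto
    next
      case False
      then show ?thesis using True wcong_wpow_snoc_winv[of _ y e] by (intro exI[of _ "- 1"]) auto
    qed
    then obtain d where d: "\<bar>d\<bar> \<le> 1" "wpow y e @ ival u \<approx> wpow y (e + d)" by blast
    note prod
    also have "(wpow y e @ iprod us') @ ival u = wpow y e @ (iprod us' @ ival u)" by simp
    also have "\<dots> \<approx> wpow y e @ ival u @ winv (ival u) @ (iprod us' @ ival u)"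
      by (rule wcong.sym[OF wcong_cancel_right])
    also have "\<dots> = (wpow y e @ ival u) @ (winv (ival u) @ iprod us' @ ival u)" by simp
    also have "\<dots> \<approx> wpow y (e + d) @ iprod us''" by (intro wcong_append d us'')
    finally have "iprod (us @ [u]) \<approx> \<dots>" .
    moreover have "cost E us'' \<le> (1 + growth / E) ^ Suc t * cost E (us @ [u])"
    proof -
      have "cost E us'' \<le> (1 + growth / E) * ((1 + growth / E) ^ t * cost E us)"
        using us''(4) IH(5) q by (meson mult_left_mono order_trans zero_le_one)
      also have "\<dots> = (1 + growth / E) ^ Suc t * cost E us" by simp
      also have "\<dots> \<le> (1 + growth / E) ^ Suc t * cost E (us @ [u])"
        using E q cost_nonneg[OF E] by (intro mult_left_mono) auto
      finally show ?thesis .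
    qed
    moreover have "length (filter (\<lambda>z. ival z \<in> {y, winv y}) (level k (us @ [u]))) = Suc t"
      using True by (simp add: t_def)
    moreover have "\<bar>e + d\<bar> \<le> int (Suc t)" using d(1) IH(4) by simp
    moreover have "level k us'' = filter (\<lambda>z. ival z \<notin> {y, winv y}) (level k (us @ [u]))"
      using True us''(3) IH(3) by auto
    ultimately show ?thesis using us''(2) by metis
  next
    case False
    have "cost E (us' @ [u]) \<le> (1 + growth / E) ^ t * cost E us + 1 * E ^ (c - wt u)"
      using IH(5) by simp
    also have "\<dots> \<le> (1 + growth / E) ^ t * cost E us + (1 + growth / E) ^ t * E ^ (c - wt u)"
      using E one_le_power[OF q, of t] by (intro add_mono mult_right_mono order_refl) (auto simp: cost_nonneg)
    finally have "cost E (us' @ [u]) \<le> (1 + growth / E) ^ t * cost E (us @ [u])"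
      by (simp add: algebra_simps)
    moreover have "length (filter (\<lambda>z. ival z \<in> {y, winv y}) (level k (us @ [u]))) = t"
      using False by (auto simp: t_def)
    moreover have "level k (us' @ [u]) = filter (\<lambda>z. ival z \<notin> {y, winv y}) (level k (us @ [u]))"
      using False IH(3) by auto
    moreover have "set (us' @ [u]) \<subseteq> items r c k" using IH(2) u by auto
    moreover have "iprod (us @ [u]) \<approx> wpow y e @ iprod (us' @ [u])" using prod by simp
    ultimately show ?thesis using IH(4) by metis
  qed
qed

text \<open>The elements of \<open>ys\<close> are extracted in their order. Every factor of weight
  \<open>k\<close> is moved once, so the exponents of \<open>1 + growth / E\<close> add up to the
  number of such factors; when \<open>ys\<close> is exhausted, only heavier factors remain.\<close>

lemma collect_level:
  assumes E: "1 \<le> E" and us: "set us \<subseteq> items r c k"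
    and ys: "\<forall>z \<in> set us. wt z = k \<longrightarrow> ival z \<in> set ys \<union> winv ` set ys"
  shows "\<exists>es us'. length es = length ys \<and> iprod us \<approx> wprod ys es @ iprod us' \<and>
           set us' \<subseteq> items r c (Suc k) \<and> (\<forall>e \<in> set es. \<bar>e\<bar> \<le> int (length (level k us))) \<and>
           cost E us' \<le> (1 + growth / E) ^ length (level k us) * cost E us"
  using us ys
proof (induction ys arbitrary: us)
  case Nil
  then have ne: "\<forall>z \<in> set us. wt z \<noteq> k" by simp
  then have "level k us = []" by (simp add: filter_empty_conv)
  moreover have "set us \<subseteq> items r c (Suc k)"
  proof
    fix z assume "z \<in> set us"
    with ne Nil(1) have "z \<in> items r c k" "wt z \<noteq> k" by auto
    then show "z \<in> items r c (Suc k)" by (simp add: items_def)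
  qed
  ultimately have "level k us = []" "set us \<subseteq> items r c (Suc k)" by blast+
  then show ?case by (intro exI[of _ "[]"] exI[of _ us]) (simp add: wcong.refl)
next
  case (Cons y ys)
  define t where "t = length (filter (\<lambda>z. ival z \<in> {y, winv y}) (level k us))"
  have q: "1 \<le> 1 + growth / E" using E by simp
  from extract_power[OF E Cons.prems(1), of y] obtain e us1 where
    1: "iprod us \<approx> wpow y e @ iprod us1" "set us1 \<subseteq> items r c k"
      "level k us1 = filter (\<lambda>z. ival z \<notin> {y, winv y}) (level k us)"
      "\<bar>e\<bar> \<le> int t" "cost E us1 \<le> (1 + growth / E) ^ t * cost E us" unfolding t_def by blast
  have split: "length (level k us) = t + length (level k us1)"
    unfolding 1(3) t_def by (rule sum_length_filter_compl[symmetric])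
  have "\<forall>z \<in> set us1. wt z = k \<longrightarrow> ival z \<in> set ys \<union> winv ` set ys"
  proof (intro ballI impI)
    fix z assume "z \<in> set us1" "wt z = k"
    then have "z \<in> set (level k us1)" by simp
    then have "z \<in> set us" "ival z \<noteq> y" "ival z \<noteq> winv y" unfolding 1(3) by auto
    with Cons.prems(2) \<open>wt z = k\<close> show "ival z \<in> set ys \<union> winv ` set ys" by auto
  qed
  from Cons.IH[OF 1(2) this] obtain es us2 where
    2: "length es = length ys" "iprod us1 \<approx> wprod ys es @ iprod us2"
      "set us2 \<subseteq> items r c (Suc k)" "\<forall>e \<in> set es. \<bar>e\<bar> \<le> int (length (level k us1))"
      "cost E us2 \<le> (1 + growth / E) ^ length (level k us1) * cost E us1" by blast
  have "wpow y e @ iprod us1 \<approx> wpow y e @ wprod ys es @ iprod us2"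
    by (intro wcong_append 2 wcong.refl)
  with 1(1) have "iprod us \<approx> wprod (y # ys) (e # es) @ iprod us2"
    using wcong.trans by simp
  moreover have "cost E us2 \<le> (1 + growth / E) ^ length (level k us) * cost E us"
  proof -
    have "cost E us2 \<le> (1 + growth / E) ^ length (level k us1) * ((1 + growth / E) ^ t * cost E us)"
      using 2(5) 1(5) q by (meson mult_left_mono order_trans zero_le_one zero_le_power)
    then show ?thesis by (simp add: split power_add mult_ac)
  qed
  moreover have "\<forall>d \<in> set (e # es). \<bar>d\<bar> \<le> int (length (level k us))"
    using 1(4) 2(4) split by fastforce
  ultimately show ?case using 2(1,3) by (intro exI[of _ "e # es"] exI[of _ us2]) auto
qed

section \<open>Splitting through the basis, and passing through all weights\<close>

definition splits :: "nat \<Rightarrow> item set \<Rightarrow> item \<Rightarrow> item list \<Rightarrow> bool" where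
  "splits k A z zs \<longleftrightarrow> ival z \<approx> iprod zs \<and> set zs \<subseteq> items r c k \<and> (\<forall>x \<in> set zs. wt x = k \<longrightarrow> x \<in> A)"

definition basis_items :: "nat \<Rightarrow> word list \<Rightarrow> item set" where
  "basis_items k ys = {x \<in> items r c k. wt x = k \<and> ival x \<in> set ys \<union> winv ` set ys}"

lemma split_list:
  assumes K: "1 \<le> K" and us: "set us \<subseteq> items r c k"
    and split: "\<And>z. z \<in> items r c k \<Longrightarrow> wt z = k \<Longrightarrow> \<exists>zs. splits k (basis_items k ys) z zs \<and> length zs \<le> K"
  shows "\<exists>vs. iprod us \<approx> iprod vs \<and> set vs \<subseteq> items r c k \<and> length vs \<le> K * length us \<and>
           (\<forall>z \<in> set vs. wt z = k \<longrightarrow> ival z \<in> set ys \<union> winv ` set ys)"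
  using us
proof (induction us)
  case Nil
  show ?case by (rule exI[of _ "[]"]) (simp add: wcong.refl)
next
  case (Cons u us)
  then obtain vs where vs: "iprod us \<approx> iprod vs" "set vs \<subseteq> items r c k" "length vs \<le> K * length us"
    "\<forall>z \<in> set vs. wt z = k \<longrightarrow> ival z \<in> set ys \<union> winv ` set ys" by auto
  from Cons.prems have u: "u \<in> items r c k" by simp
  obtain zs where zs: "ival u \<approx> iprod zs" "set zs \<subseteq> items r c k" "length zs \<le> K"
    "\<forall>z \<in> set zs. wt z = k \<longrightarrow> ival z \<in> set ys \<union> winv ` set ys"
  proof (cases "wt u = k")
    case True
    from split[OF u this] that show ?thesis by (auto simp: splits_def basis_items_def)
  next
    case False
    \<comment> \<open>A heavier factor is kept as it is and counts as one, within the bound because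
      \<open>1 \<le> K\<close>.\<close>
    then show ?thesis using that[of "[u]"] u K by (auto intro: wcong.refl)
  qed
  from zs vs show ?case
    by (intro exI[of _ "zs @ vs"]) (auto intro: wcong_append)
qed

text \<open>After splitting there are at most \<open>K X\<close> factors, each of cost at most
  \<open>E ^ c\<close> with \<open>E = growth * (K X + 1)\<close>; the 3 bounds e, the total growth
  of the cost during the moves. The summand 1 keeps E at least 1 for an empty list. The value is
  polynomial in \<open>X\<close>.\<close>

definition stage_bound :: "nat \<Rightarrow> real \<Rightarrow> real" where
  "stage_bound K X = 3 * (real K * X) * (growth * (real K * X + 1)) ^ c"

lemma collection_stage:
  assumes K: "1 \<le> K" and us: "set us \<subseteq> items r c k" and X: "real (length us) \<le> X"
    and split: "\<And>z. z \<in> items r c k \<Longrightarrow> wt z = k \<Longrightarrow> \<exists>zs. splits k (basis_items k ys) z zs \<and> length zs \<le> K"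
  shows "\<exists>es us'. length es = length ys \<and> iprod us \<approx> wprod ys es @ iprod us' \<and>
           set us' \<subseteq> items r c (Suc k) \<and> (\<forall>e \<in> set es. real_of_int \<bar>e\<bar> \<le> real K * X) \<and>
           real (length us') \<le> stage_bound K X"
proof -
  define E where "E = growth * (real K * X + 1)"
  from split_list[OF K us split] obtain vs where
    vs: "iprod us \<approx> iprod vs" "set vs \<subseteq> items r c k" "length vs \<le> K * length us"
      "\<forall>z \<in> set vs. wt z = k \<longrightarrow> ival z \<in> set ys \<union> winv ` set ys" by blast
  have X0: "0 \<le> real K * X" using X by simp
  have "real (length vs) \<le> real (K * length us)" using vs(3) by (rule of_nat_mono)
  also have "\<dots> \<le> real K * X" using X by (simp add: mult_left_mono)
  finally have len: "real (length vs) \<le> real K * X" .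
  have "1 * 1 \<le> growth * (real K * X + 1)" using X0 by (intro mult_mono) auto
  then have E: "1 \<le> E" by (simp add: E_def)
  from collect_level[OF E vs(2,4)] obtain es us' where
    res: "length es = length ys" "iprod vs \<approx> wprod ys es @ iprod us'"
      "set us' \<subseteq> items r c (Suc k)" "\<forall>e \<in> set es. \<bar>e\<bar> \<le> int (length (level k vs))"
      "cost E us' \<le> (1 + growth / E) ^ length (level k vs) * cost E vs" by blast
  define T where "T = length (level k vs)"
  have T: "real T \<le> real K * X"
    unfolding T_def by (rule order_trans[OF of_nat_mono[OF length_filter_le] len])
  \<comment> \<open>By \<open>1 + x \<le> exp x\<close> the T moves cost at most
    \<open>exp (T * growth / E)\<close>, and E was chosen so that
    \<open>growth * T \<le> E\<close>.\<close>
  have "(1 + growth / E) ^ T \<le> exp (growth / E) ^ T"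
    using E exp_ge_add_one_self[of "growth / E"] by (intro power_mono) auto
  also have "\<dots> = exp (real T * (growth / E))" by (rule exp_of_nat_mult[symmetric])
  also have "\<dots> \<le> exp 1"
  proof -
    have "growth * real T \<le> E" unfolding E_def using T by (intro mult_left_mono) auto
    then show ?thesis using E by (simp add: field_simps)
  qed
  also have "\<dots> \<le> 3" by (rule exp_le)
  finally have q: "(1 + growth / E) ^ T \<le> 3" .
  have "cost E vs \<le> real (length vs) * E ^ (c - 0)"
    by (rule cost_le_items[OF E]) (use vs(2) items_antimono[of 0 k r c] in auto)
  also have "\<dots> \<le> real K * X * E ^ c" using len E by (intro mult_mono) auto
  finally have "(1 + growth / E) ^ T * cost E vs \<le> 3 * (real K * X * E ^ c)"
    using q cost_nonneg[OF E] by (intro mult_mono) auto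
  \<comment> \<open>Every factor costs at least 1, so the cost bounds their number.\<close>
  with res(5) length_le_cost[OF E, of us'] have "real (length us') \<le> stage_bound K X"
    by (simp add: stage_bound_def E_def T_def mult.assoc)
  moreover have "\<forall>e \<in> set es. real_of_int \<bar>e\<bar> \<le> real K * X"
  proof
    fix e assume "e \<in> set es"
    then have "\<bar>e\<bar> \<le> int T" using res(4) by (simp add: T_def)
    then have "real_of_int \<bar>e\<bar> \<le> real_of_int (int T)" by (simp only: of_int_le_iff)
    with T show "real_of_int \<bar>e\<bar> \<le> real K * X" by simp
  qed
  moreover have "iprod us \<approx> wprod ys es @ iprod us'" using vs(1) res(2) by (rule wcong.trans)
  ultimately show ?thesis using res(1,3) by blast
qed

text \<open>Stage i starts with at most \<open>stage_bound K ^^ i\<close> applied to the length of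
  \<open>w\<close> factors. The sum over the stages replaces a maximum so that the bound remains
  polynomial.\<close>

lemma collection:
  assumes K: "1 \<le> K" and c: "1 \<le> c" and w: "over r w"
    and split: "\<And>k z. 1 \<le> k \<Longrightarrow> k \<le> c \<Longrightarrow> z \<in> items r c k \<Longrightarrow> wt z = k \<Longrightarrow>
      \<exists>zs. splits k (basis_items k (B k)) z zs \<and> length zs \<le> K"
  shows "j \<le> c \<Longrightarrow> \<exists>es us. length es = length (concat (map B [1..<Suc j])) \<and>
           w \<approx> wprod (concat (map B [1..<Suc j])) es @ iprod us \<and> set us \<subseteq> items r c (Suc j) \<and>
           real (length us) \<le> (stage_bound K ^^ j) (real (length w)) \<and>
           (\<forall>e \<in> set es. real_of_int \<bar>e\<bar> \<le> (\<Sum>i<j. real K * (stage_bound K ^^ i) (real (length w))))"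
proof (induction j)
  case 0
  from over_as_iprod[OF w c] show ?case by (auto intro: wcong.refl)
next
  case (Suc j)
  let ?Y = "concat (map B [1..<Suc j])" and ?X = "\<lambda>i. (stage_bound K ^^ i) (real (length w))"
  from Suc obtain es us where 1: "length es = length ?Y" "w \<approx> wprod ?Y es @ iprod us"
    "set us \<subseteq> items r c (Suc j)" "real (length us) \<le> ?X j"
    "\<forall>e \<in> set es. real_of_int \<bar>e\<bar> \<le> (\<Sum>i<j. real K * ?X i)" by auto
  have "\<exists>es' us'. length es' = length (B (Suc j)) \<and> iprod us \<approx> wprod (B (Suc j)) es' @ iprod us' \<and>
      set us' \<subseteq> items r c (Suc (Suc j)) \<and> (\<forall>e \<in> set es'. real_of_int \<bar>e\<bar> \<le> real K * ?X j) \<and>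
      real (length us') \<le> stage_bound K (?X j)"
    by (rule collection_stage[OF K 1(3,4)]) (use Suc.prems split in auto)
  then obtain es' us' where 2: "length es' = length (B (Suc j))"
    "iprod us \<approx> wprod (B (Suc j)) es' @ iprod us'" "set us' \<subseteq> items r c (Suc (Suc j))"
    "\<forall>e \<in> set es'. real_of_int \<bar>e\<bar> \<le> real K * ?X j" "real (length us') \<le> stage_bound K (?X j)"
    by blast
  have Y: "concat (map B [1..<Suc (Suc j)]) = ?Y @ B (Suc j)" by simp
  have "wprod ?Y es @ iprod us \<approx> wprod ?Y es @ wprod (B (Suc j)) es' @ iprod us'"
    by (intro wcong_append 2 wcong.refl)
  with 1(2) have "w \<approx> wprod ?Y es @ wprod (B (Suc j)) es' @ iprod us'" by (rule wcong.trans)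
  moreover have "wprod (?Y @ B (Suc j)) (es @ es') = wprod ?Y es @ wprod (B (Suc j)) es'"
    using 1(1) by (intro wprod_append) simp
  ultimately have 3: "w \<approx> wprod (?Y @ B (Suc j)) (es @ es') @ iprod us'" by simp
  have nonneg: "0 \<le> ?X i" for i
    by (induction i) (auto simp: stage_bound_def)
  then have sum0: "0 \<le> (\<Sum>i<j. real K * ?X i)" by (intro sum_nonneg) auto
  have "\<forall>e \<in> set (es @ es'). real_of_int \<bar>e\<bar> \<le> (\<Sum>i<Suc j. real K * ?X i)"
  proof
    fix e assume "e \<in> set (es @ es')"
    then have "real_of_int \<bar>e\<bar> \<le> (\<Sum>i<j. real K * ?X i) \<or> real_of_int \<bar>e\<bar> \<le> real K * ?X j"
      using 1(5) 2(4) by auto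
    moreover have "0 \<le> real K * ?X j" using nonneg by simp
    ultimately show "real_of_int \<bar>e\<bar> \<le> (\<Sum>i<Suc j. real K * ?X i)" using sum0 by auto
  qed
  with 1(1) 2 3 show ?case unfolding Y
    by (intro exI[of _ "es @ es'"] exI[of _ us']) simp
qed

end

section \<open>Uniformity in the rank and in the basis\<close>

definition rename :: "(nat \<Rightarrow> nat) \<Rightarrow> item \<Rightarrow> item" where
  "rename p z = (map (apfst p) (fst z), snd z)"

abbreviation support :: "item \<Rightarrow> nat set" where
  "support z \<equiv> fst ` set (fst z)"

lemma subst_restrict_ival:
  "support z \<subseteq> S \<Longrightarrow> subst (restrict_letters S p) (ival z) = ival (rename p z)"
proof -
  assume S: "support z \<subseteq> S"
  have "map (subst (restrict_letters S p)) (map (\<lambda>l. [l]) (fst z)) = map (\<lambda>l. [l]) (map (apfst p) (fst z))"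
    using S by (simp add: subst_restrict_id image_subset_iff)
  then have "subst (restrict_letters S p) (letter_comm (fst z)) = letter_comm (map (apfst p) (fst z))"
    by (simp only: subst_lcomm)
  then show ?thesis by (simp add: ival_def rename_def)
qed

lemma subst_restrict_ival_trivial:
  assumes "\<not> support z \<subseteq> S"
  shows "wcong R (subst (restrict_letters S p) (ival z)) []"
proof -
  from assms obtain l where l: "l \<in> set (fst z)" "fst l \<notin> S" by auto
  then have "subst (restrict_letters S p) [l] = []" by (simp add: subst_single restrict_letters_def)
  with l(1) have "[] \<in> set (map (subst (restrict_letters S p)) (map (\<lambda>l. [l]) (fst z)))"
    by force
  then have e: "wcong R (subst (restrict_letters S p) (letter_comm (fst z))) []"
    unfolding subst_lcomm by (rule wcong_lcomm_Nil)
  with wcong_winv[OF e] show ?thesis by (simp add: ival_def)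
qed

lemma subst_restrict_iprod:
  "wcong R (subst (restrict_letters S p) (iprod zs))
     (iprod (map (rename p) (filter (\<lambda>z. support z \<subseteq> S) zs)))"
proof (induction zs)
  case (Cons z zs)
  have "wcong R (subst (restrict_letters S p) (ival z)) (if support z \<subseteq> S then ival (rename p z) else [])"
    using subst_restrict_ival subst_restrict_ival_trivial by (auto intro: wcong.refl)
  from wcong_append[OF this Cons] show ?case by (cases "support z \<subseteq> S") simp_all
qed (simp add: wcong.refl)

lemma finite_items: "finite (items r c k)"
proof -
  have "items r c k \<subseteq> {as. set as \<subseteq> {..<r} \<times> UNIV \<and> length as \<le> c} \<times> UNIV"
    by (force simp: items_def over_def)
  then show ?thesis
    by (rule finite_subset) (intro finite_cartesian_product finite_lists_length_le finite_UNIV; simp)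
qed

lemma items_mono_rank: "s \<le> r \<Longrightarrow> items s c k \<subseteq> items r c k"
  by (fastforce simp: items_def over_def)

text \<open>After renaming letters, an item of weight at most c and the basis items supported on its letters
  form one of finitely many configurations, so the number of factors is bounded in terms of c alone.\<close>
lemma splits_bound_small_rank:
  "\<exists>K. \<forall>s \<le> c. \<forall>k \<le> c. \<forall>z \<in> items s c k. \<forall>A \<subseteq> items s c k.
     (\<exists>zs. splits s c k A z zs) \<longrightarrow> (\<exists>zs. splits s c k A z zs \<and> length zs \<le> K)"
proof -
  define I where "I = {..c} \<times> {..c} \<times> items c c 0 \<times> Pow (items c c 0)"
  \<comment> \<open>Where no splitting exists, \<open>LEAST\<close> returns an unspecified number;
    this can only enlarge the maximum.\<close>
  define f where "f = (\<lambda>(s, k, z, A). LEAST n. \<exists>zs. splits s c k A z zs \<and> length zs = n)"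
  have "finite I" by (simp add: I_def finite_items)
  have sub: "items s c k \<subseteq> items c c 0" if "s \<le> c" for s k
    using items_mono_rank[OF that] items_antimono[of 0 k c c] by blast
  show ?thesis
  proof (intro exI[of _ "Max (f ` I)"] allI ballI impI)
    fix s k z A assume s: "s \<le> c" and k: "k \<le> c" and zA: "z \<in> items s c k" "A \<subseteq> items s c k"
      and "\<exists>zs. splits s c k A z zs"
    then have "\<exists>n. \<exists>zs. splits s c k A z zs \<and> length zs = n" by blast
    then have "\<exists>zs. splits s c k A z zs \<and> length zs = f (s, k, z, A)"
      unfolding f_def prod.case by (rule LeastI_ex)
    moreover have "(s, k, z, A) \<in> I" using s k zA sub[OF s, of k] by (auto simp: I_def)
    then have "f (s, k, z, A) \<le> Max (f ` I)" using \<open>finite I\<close> by (intro Max_ge) auto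
    ultimately show "\<exists>zs. splits s c k A z zs \<and> length zs \<le> Max (f ` I)" by auto
  qed
qed

lemma rename_in_items:
  "z \<in> items r c k \<Longrightarrow> (\<And>a. a \<in> support z \<Longrightarrow> p a < s) \<Longrightarrow> rename p z \<in> items s c k"
  by (auto simp: items_def rename_def over_def)

lemma wt_rename [simp]: "wt (rename p z) = wt z"
  by (simp add: rename_def)

lemma rename_rename: "(\<And>a. a \<in> support z \<Longrightarrow> q (p a) = a) \<Longrightarrow> rename q (rename p z) = z"
  by (cases z) (force simp: rename_def intro!: map_idI)

lemma support_items: "z \<in> items r c k \<Longrightarrow> support z \<subseteq> {..<r}"
  by (auto simp: items_def over_def)

text \<open>The support of \<open>z\<close> has at most \<open>c\<close> letters. Killing all other
  letters and renaming these to an initial segment carries the given splitting to rank at most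
  \<open>c\<close>, where a short one exists; renaming back yields a short splitting in rank
  \<open>r\<close>.\<close>

lemma splits_bounded:
  assumes K: "\<forall>s \<le> c. \<forall>k \<le> c. \<forall>z \<in> items s c k. \<forall>A \<subseteq> items s c k.
     (\<exists>zs. splits s c k A z zs) \<longrightarrow> (\<exists>zs. splits s c k A z zs \<and> length zs \<le> K)"
    and z: "z \<in> items r c k" and A: "A \<subseteq> items r c k" and sp: "splits r c k A z zs"
  shows "\<exists>zs. splits r c k A z zs \<and> length zs \<le> K"
proof -
  define S where "S = support z"
  define s where "s = card S"
  have "card (set (fst z)) \<le> wt z" by (rule card_length)
  then have s: "s \<le> c" unfolding s_def S_def using z card_image_le[of "set (fst z)" fst]
    by (simp add: items_def)
  have k: "k \<le> c" using z by (simp add: items_def)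
  have Sr: "S \<subseteq> {..<r}" unfolding S_def by (rule support_items[OF z])
  have "finite S" by (simp add: S_def)
  from ex_bij_betw_finite_nat[OF this] obtain p where p: "bij_betw p S {..<s}"
    unfolding s_def atLeast0LessThan by blast
  define q where "q = inv_into S p"
  have qp: "q (p a) = a" if "a \<in> S" for a
    using p that by (simp add: q_def bij_betw_def inv_into_f_f)
  have pS: "p a < s" if "a \<in> S" for a using p that by (auto simp: bij_betw_def)
  have qS: "q b \<in> S" if "b < s" for b
    using p that unfolding q_def bij_betw_def by (intro inv_into_into) auto
  define A' where "A' = rename p ` {x \<in> A. support x \<subseteq> S}"
  define zs' where "zs' = map (rename p) (filter (\<lambda>x. support x \<subseteq> S) zs)"
  from sp have eq: "nil_eq r c (ival z) (iprod zs)" and sub: "set zs \<subseteq> items r c k"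
    and inA: "\<forall>x \<in> set zs. wt x = k \<longrightarrow> x \<in> A" by (auto simp: splits_def nil_eq_def)
  have ren: "rename p x \<in> items s c k" if "x \<in> items r c k" "support x \<subseteq> S" for x
    using pS that(2) by (intro rename_in_items[OF that(1)]) blast
  have z': "rename p z \<in> items s c k" by (rule ren[OF z]) (simp add: S_def)
  have A': "A' \<subseteq> items s c k" unfolding A'_def using A ren by blast
  \<comment> \<open>The item \<open>z\<close> is only renamed here, while every factor of
    \<open>zs\<close> with a letter outside \<open>S\<close> becomes trivial.\<close>
  have "nil_eq s c (subst (restrict_letters S p) (ival z)) (subst (restrict_letters S p) (iprod zs))"
    by (rule nil_eq_subst[OF eq]) (auto simp: restrict_letters_def pS)
  then have "nil_eq s c (ival (rename p z)) (subst (restrict_letters S p) (iprod zs))"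
    by (simp add: subst_restrict_ival S_def)
  then have "nil_eq s c (ival (rename p z)) (iprod zs')"
    unfolding nil_eq_def zs'_def using subst_restrict_iprod by (rule wcong.trans)
  moreover have "set zs' \<subseteq> items s c k" unfolding zs'_def set_map set_filter using sub ren by blast
  moreover have "\<forall>x \<in> set zs'. wt x = k \<longrightarrow> x \<in> A'" using inA by (auto simp: zs'_def A'_def)
  ultimately have "splits s c k A' (rename p z) zs'" by (simp add: splits_def nil_eq_def)
  with K s k z' A' obtain ws where ws: "splits s c k A' (rename p z) ws" "length ws \<le> K" by blast
  then have weq: "nil_eq s c (ival (rename p z)) (iprod ws)" and wsub: "set ws \<subseteq> items s c k"
    and winA: "\<forall>x \<in> set ws. wt x = k \<longrightarrow> x \<in> A'" by (auto simp: splits_def nil_eq_def)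
  let ?f = "restrict_letters {..<s} q"
  have "nil_eq r c (subst ?f (ival (rename p z))) (subst ?f (iprod ws))"
    by (rule nil_eq_subst[OF weq]) (use qS Sr in \<open>auto simp: restrict_letters_def\<close>)
  moreover have "subst ?f (ival (rename p z)) = ival z"
    using support_items[OF z'] qp by (simp add: subst_restrict_ival rename_rename S_def)
  \<comment> \<open>On the way back all letters lie in the initial segment, so no factor is
    lost.\<close>
  moreover have "filter (\<lambda>x. support x \<subseteq> {..<s}) ws = ws"
    using wsub by (intro filter_True ballI) (rule support_items[of _ s c k], blast)
  ultimately have "nil_eq r c (ival z) (iprod (map (rename q) ws))"
    using subst_restrict_iprod[of "comm_relators r (Suc c)" "{..<s}" q ws]
    unfolding nil_eq_def by (auto intro: wcong.trans)
  moreover have "set (map (rename q) ws) \<subseteq> items r c k"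
  proof clarsimp
    fix as b assume "(as, b) \<in> set ws"
    then have x: "(as, b) \<in> items s c k" using wsub by blast
    show "rename q (as, b) \<in> items r c k"
      using support_items[OF x] qS Sr by (intro rename_in_items[OF x]) blast
  qed
  moreover have "\<forall>x \<in> set (map (rename q) ws). wt x = k \<longrightarrow> x \<in> A"
  proof (intro ballI impI)
    fix x assume "x \<in> set (map (rename q) ws)" "wt x = k"
    then obtain x' where x': "x' \<in> set ws" "x = rename q x'" "wt x' = k" by auto
    \<comment> \<open>A factor of weight \<open>k\<close> is the renaming of some member of
      \<open>A\<close> supported on \<open>S\<close>, and \<open>q\<close> undoes \<open>p\<close>
      there.\<close>
    with winA obtain y where y: "y \<in> A" "support y \<subseteq> S" "x' = rename p y" by (auto simp: A'_def)
    then have "x = y" using x'(2) qp by (auto intro!: rename_rename)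
    with y show "x \<in> A" by simp
  qed
  ultimately have "splits r c k A z (map (rename q) ws)" by (simp add: splits_def nil_eq_def)
  with ws(2) show ?thesis by (intro exI[of _ "map (rename q) ws"]) simp
qed

section \<open>Splittings obtained from a Malcev basis\<close>

lemma basic_comm_item:
  assumes "basic_comm r k y" "1 \<le> k" "k \<le> c"
  shows "\<exists>x \<in> items r c k. wt x = k \<and> ival x = y"
proof -
  from assms obtain as where as: "length as = k" "over r as"
    "y = letter_comm as \<or> y = winv (letter_comm as)" by (auto simp: basic_comm_def)
  then show ?thesis
    \<comment> \<open>The sign of the item is the truth value of \<open>y = letter_comm as\<close>;
      if this fails, \<open>y\<close> must be the inverse.\<close>
    using assms(2,3) by (intro bexI[of _ "(as, y = letter_comm as)"]) (auto simp: ival_def items_def)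
qed

lemma wprod_as_iprod:
  assumes "\<forall>y \<in> set ys. basic_comm r k y" "1 \<le> k" "k \<le> c"
  shows "\<exists>zs. wprod ys es = iprod zs \<and> set zs \<subseteq> basis_items r c k ys"
proof -
  have pow: "\<exists>zs. wpow y e = iprod zs \<and> set zs \<subseteq> basis_items r c k ys" if "y \<in> set ys" for y e
  proof -
    from basic_comm_item that assms obtain x where x: "x \<in> items r c k" "wt x = k" "ival x = y" by metis
    have rep: "iprod (replicate n v) = concat (replicate n (ival v))" for n v by (induction n) auto
    have "x \<in> basis_items r c k ys" "iinv x \<in> basis_items r c k ys"
      using x that by (auto simp: basis_items_def)
    then show ?thesis using x(3)
      by (intro exI[of _ "replicate (nat \<bar>e\<bar>) (if 0 \<le> e then x else iinv x)"])
         (auto simp: wpow_def rep)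
  qed
  have "\<exists>zs. wprod ys' es = iprod zs \<and> set zs \<subseteq> basis_items r c k ys" if "set ys' \<subseteq> set ys" for ys'
    using that
  proof (induction ys' arbitrary: es)
    case Nil
    show ?case by (intro exI[of _ "[]"]) simp
  next
    case (Cons y ys')
    show ?case
    proof (cases es)
      case Nil
      then show ?thesis by (intro exI[of _ "[]"]) (simp add: wprod_def)
    next
      case es: (Cons e es')
      from Cons obtain zs where "wprod ys' es' = iprod zs" "set zs \<subseteq> basis_items r c k ys" by force
      moreover from pow[of y e] Cons obtain vs where
        "wpow y e = iprod vs" "set vs \<subseteq> basis_items r c k ys" by auto
      ultimately show ?thesis using es by (intro exI[of _ "vs @ zs"]) auto
    qed
  qed
  then show ?thesis by blast
qed

text \<open>The layer basis expresses \<open>z\<close> modulo gamma_(k+1) by basis items. Lifting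
  this to class \<open>c\<close> with \<open>nil_eq_lower_class\<close> adds a tail of items of
  weight above \<open>k\<close>, as a splitting permits.\<close>

lemma layer_basis_splits:
  assumes basic: "\<forall>y \<in> set ys. basic_comm r k y" and k: "1 \<le> k" "k \<le> c"
    and basis: "layer_basis r k ys" and z: "z \<in> items r c k" "wt z = k"
  shows "\<exists>zs. splits r c k (basis_items r c k ys) z zs"
proof -
  have "letter_comm (fst z) \<in> comm_relators r k"
    unfolding comm_relators_def using z
    by (force simp: items_def over_def intro!: exI[of _ "map (\<lambda>l. [l]) (fst z)"])
  then have "in_gamma r k (letter_comm (fst z))" by (rule in_gamma.gen)
  with in_gamma.inv[OF this] have "in_gamma r k (ival z)" by (simp add: ival_def)
  with basis obtain es where es: "nil_eq r k (ival z) (wprod ys es)" by (auto simp: layer_basis_def)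
  from wprod_as_iprod[OF basic k] obtain vs where
    vs: "wprod ys es = iprod vs" "set vs \<subseteq> basis_items r c k ys" by blast
  have vs': "set vs \<subseteq> items r c k" using vs(2) by (auto simp: basis_items_def)
  have "1 \<le> c" using k by simp
  from nil_eq_lower_class[OF es this] obtain h where h: "h \<in> gam r c (Suc k)"
    "nil_eq r c (ival z) (iprod vs @ h)"
    by (auto simp: subst_retract over_ival[OF z(1)] over_iprod[OF vs'] vs(1) nil_eq_def)
  from h(1) obtain hs where hs: "set hs \<subseteq> items r c (Suc k)" "nil_eq r c h (iprod hs)"
    by (auto simp: gam_def nil_eq_def)
  have "nil_eq r c (ival z) (iprod (vs @ hs))"
    using h(2) wcong_append[OF wcong.refl[of _ "iprod vs"] hs(2)[unfolded nil_eq_def]]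
    unfolding nil_eq_def by (auto intro: wcong.trans)
  moreover have "set (vs @ hs) \<subseteq> items r c k" using vs' hs(1) items_antimono[of k "Suc k" r c] by auto
  moreover have "\<forall>x \<in> set (vs @ hs). wt x = k \<longrightarrow> x \<in> basis_items r c k ys"
    using vs(2) hs(1) by (auto simp: items_def subset_iff)
  ultimately show ?thesis unfolding splits_def nil_eq_def by blast
qed

lemma malcev_splits:
  assumes B: "malcev_comm_basis r c B" and k: "1 \<le> k" "k \<le> c" and z: "z \<in> items r c k" "wt z = k"
  shows "\<exists>zs. splits r c k (basis_items r c k (B k)) z zs"
proof (cases "k = 1")
  \<comment> \<open>In weight one the basis consists of the generators, so \<open>z\<close> is its
    own splitting.\<close>
  case True
  with z obtain a s where "fst z = [(a, s)]" "a < r"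
    by (cases "fst z") (auto simp: items_def)
  then have "ival z = [(a, True)] \<or> ival z = winv [(a, True)]" "[(a, True)] \<in> set (B 1)"
    using B by (auto simp: ival_def malcev_comm_basis_def)
  then have "ival z \<in> set (B k) \<union> winv ` set (B k)"
    unfolding True by (metis UnCI imageI)
  then have "z \<in> basis_items r c k (B k)" using z by (simp add: basis_items_def)
  then show ?thesis using z by (intro exI[of _ "[z]"]) (auto simp: splits_def intro: wcong.refl)
next
  case False
  with B k have "\<forall>y \<in> set (B k). basic_comm r k y" "layer_basis r k (B k)"
    by (auto simp: malcev_comm_basis_def)
  then show ?thesis using layer_basis_splits k z by blast
qed

theorem mainTheorem1:
  fixes c :: nat
  assumes "c \<ge> 1"
  shows "\<exists>P :: real poly. \<forall>r \<ge> 1. \<forall>B w.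
           malcev_comm_basis r c B \<longrightarrow> over r w \<longrightarrow>
           (\<exists>\<alpha> :: int list. length \<alpha> = length (malcev_list c B) \<and>
              nil_eq r c w (wprod (malcev_list c B) \<alpha>) \<and>
              (\<forall>a \<in> set \<alpha>. real_of_int \<bar>a\<bar> \<le> poly P (real (length w))))"
proof -
  \<comment> \<open>The constant is fixed before the rank, basis and word are introduced, so it
    depends on \<open>c\<close> alone.\<close>
  obtain K0 where K0: "\<forall>s \<le> c. \<forall>k \<le> c. \<forall>z \<in> items s c k. \<forall>A \<subseteq> items s c k.
     (\<exists>zs. splits s c k A z zs) \<longrightarrow> (\<exists>zs. splits s c k A z zs \<and> length zs \<le> K0)"
    using splits_bound_small_rank by blast
  define K where "K = Suc K0"
  \<comment> \<open>This is \<open>stage_bound\<close> acting on polynomials; iteration starts at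
    the indeterminate \<open>[:0, 1:]\<close>, to be evaluated at the word length.\<close>
  define step :: "real poly \<Rightarrow> real poly" where
    "step p = smult (3 * real K) p * (smult (2 ^ 4 ^ c) (smult (real K) p + 1)) ^ c" for p
  define P where "P = (\<Sum>i<c. smult (real K) ((step ^^ i) [:0, 1:]))"
  have step: "poly ((step ^^ i) [:0, 1:]) x = (stage_bound c K ^^ i) x" for i x
    by (induction i) (simp_all add: step_def stage_bound_def poly_power)
  show ?thesis
  proof (intro exI[of _ P] allI impI)
    fix r B w assume B: "malcev_comm_basis r c B" and w: "over r w"
    have split: "\<exists>zs. splits r c k (basis_items r c k (B k)) z zs \<and> length zs \<le> K"
      if "1 \<le> k" "k \<le> c" "z \<in> items r c k" "wt z = k" for k z
    proof -
      from malcev_splits[OF B that] obtain zs where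
        "splits r c k (basis_items r c k (B k)) z zs" by blast
      from splits_bounded[OF K0 that(3) _ this] show ?thesis
        by (force simp: basis_items_def K_def)
    qed
    have "1 \<le> K" by (simp add: K_def)
    from collection[OF this assms w split order_refl] obtain es us where
      res: "length es = length (malcev_list c B)"
        "wcong (comm_relators r (Suc c)) w (wprod (malcev_list c B) es @ iprod us)"
        "set us \<subseteq> items r c (Suc c)"
        "\<forall>e \<in> set es. real_of_int \<bar>e\<bar> \<le> (\<Sum>i<c. real K * (stage_bound c K ^^ i) (real (length w)))"
      unfolding malcev_list_def by blast
    \<comment> \<open>No item has weight above \<open>c\<close>, so the remainder after the last
      stage is empty.\<close>
    have "us = []" using res(3) by (cases us) (auto simp: items_def)
    with res show "\<exists>\<alpha>. length \<alpha> = length (malcev_list c B) \<and>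
        nil_eq r c w (wprod (malcev_list c B) \<alpha>) \<and>
        (\<forall>a \<in> set \<alpha>. real_of_int \<bar>a\<bar> \<le> poly P (real (length w)))"
      by (intro exI[of _ es]) (simp add: nil_eq_def P_def poly_sum step)
  qed
qed

end
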